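(* Let $C\subseteq[-1,1]$ be a compact infinite set and let $\Gamma:=\{z\in\mathbb{C}:|z|=1,\ \operatorname{Re} z\in C\}$. Let $n\in\mathbb{N}$, let $b_n:=1$, let $$P_{n}(z):=b_{n}z^n+b_{n-1}z^{n-1}+\ldots+b_1z+b_0$$ be the minimal polynomial of degree $n$ on $\Gamma$, and let $k^*\in\{0,1,\ldots,n\}$ be defined by $k^*:=\min\{k:b_{k}\neq0\}$. If $k^*\neq n$, i.e., if $P_{n}(z)\neq z^n$, then $$L_{n}(\Gamma)\geq\sqrt{2|b_{k^*}|}\,(\operatorname{cap}\Gamma)^{n-k^*}.$$
   Context: Here $\mathbb{N}=\{1,2,3,\ldots\}$. For a compact infinite set $S\subset\mathbb{C}$ and $n\in\mathbb{N}$, the minimum deviation of degree $n$ on $S$ is $$L_n(S):=\min_{c_0,\ldots,c_{n-1}\in\mathbb{C}}\ \max_{z\in S}\Bigl|z^n+\sum_{k=0}^{n-1}c_k z^k\Bigr|.$$ The monic polynomial of degree $n$ for which the minimum is attained is called the minimal polynomial (or Chebyshev polynomial) of degree $n$ on $S$. The logarithmic capacity of $S$ is $\operatorname{cap} S:=\lim_{n\to\infty}\sqrt[n]{L_n(S)}$ (the limit exists by Fekete's theorem). *)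

theory Defs
  imports "HOL-Analysis.Analysis" "HOL-Computational_Algebra.Polynomial"
begin

definition monic_polys :: "nat \<Rightarrow> complex poly set" where
  "monic_polys n = {p. degree p = n \<and> lead_coeff p = 1}"

text \<open>For compact nonempty \<open>S\<close> this supremum is a maximum.\<close>
definition max_modulus :: "complex set \<Rightarrow> complex poly \<Rightarrow> real" where
  "max_modulus S p = (SUP z\<in>S. cmod (poly p z))"

text \<open>For compact infinite \<open>S\<close> the infimum is attained, so it is the minimum over all choices of
  the lower-order coefficients.\<close>
definition min_deviation :: "nat \<Rightarrow> complex set \<Rightarrow> real" where
  "min_deviation n S = (INF p\<in>monic_polys n. max_modulus S p)"

definition is_minimal_poly :: "nat \<Rightarrow> complex set \<Rightarrow> complex poly \<Rightarrow> bool" where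
  "is_minimal_poly n S p \<longleftrightarrow> p \<in> monic_polys n \<and> max_modulus S p = min_deviation n S"

text \<open>The limit exists for compact infinite \<open>S\<close> by Fekete's theorem; otherwise \<open>lim\<close> may be
  an unspecified value. The term for \<open>n = 0\<close> is irrelevant.\<close>
definition log_capacity :: "complex set \<Rightarrow> real" where
  "log_capacity S = lim (\<lambda>n. root n (min_deviation n S))"

end

theory Submission
  imports Defs
begin

text \<open>
  On the unit circle \<open>P\<close> may be replaced by \<open>Q = P / z\<^sup>k\<close>, which has degree \<open>m = n - k\<close> and constant
  term \<open>b\<^sub>k\<close>, and there \<open>z\<^sup>m |Q z|\<^sup>2\<close> is a polynomial of degree \<open>2 m\<close> with leading
  coefficient \<open>cnj b\<^sub>k\<close>. If \<open>M\<close> is the maximum of \<open>|P|\<close> on \<open>\<Gamma>\<close>, then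
  \<open>0 \<le> |Q|\<^sup>2 \<le> M\<^sup>2\<close>, so \<open>z\<^sup>m (|Q z|\<^sup>2 - M\<^sup>2/2) / cnj b\<^sub>k\<close> is a monic polynomial of
  degree \<open>2 m\<close> bounded by \<open>M\<^sup>2 / (2 |b\<^sub>k|)\<close> on \<open>\<Gamma>\<close>. Since the minimum deviations are
  submultiplicative in the degree, the capacity to the power \<open>2 m\<close> is at most the minimum deviation
  of degree \<open>2 m\<close>.
\<close>

section \<open>Fekete's lemma for submultiplicative sequences\<close>

lemma submultiplicative_power_bound:
  fixes a :: "nat \<Rightarrow> real"
  assumes nonneg: "\<And>n. 0 \<le> a n" and submult: "\<And>m n. a (m + n) \<le> a m * a n"
  shows "a (q * N + r) \<le> a N ^ q * a r"
proof (induction q)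
  case (Suc q)
  have "a (Suc q * N + r) \<le> a N * a (q * N + r)"
    using submult[of N "q * N + r"] by (simp add: algebra_simps)
  also have "\<dots> \<le> a N * (a N ^ q * a r)"
    using Suc nonneg by (intro mult_left_mono) auto
  finally show ?case by (simp add: algebra_simps)
qed simp

text \<open>Fekete's lemma in multiplicative form, proved without logarithms so that zero values of
  \<open>a\<close> are covered. The lower side is immediate from the infimum; for the upper side,
  division with remainder by an \<open>N\<close> whose root is close to \<open>l\<close> controls
  every \<open>a n\<close>.\<close>

lemma submultiplicative_root_limit:
  fixes a :: "nat \<Rightarrow> real"
  assumes nonneg: "\<And>n. 0 \<le> a n" and submult: "\<And>m n. a (m + n) \<le> a m * a n"
  shows "(\<lambda>n. root n (a n)) \<longlonglongrightarrow> (INF n\<in>{1..}. root n (a n))"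
proof -
  define l where "l = (INF n\<in>{1..}. root n (a n))"
  have bdd: "bdd_below ((\<lambda>n. root n (a n)) ` {1..})"
    using nonneg by (intro bdd_belowI2[of _ 0]) (auto simp: real_root_ge_zero)
  have lower: "l \<le> root n (a n)" if "n \<ge> 1" for n
    unfolding l_def using that by (intro cINF_lower bdd) auto
  have l0: "0 \<le> l"
    unfolding l_def using nonneg by (intro cINF_greatest) (auto simp: real_root_ge_zero)
  have upper: "\<forall>\<^sub>F n in sequentially. root n (a n) < c'" if c': "l < c'" for c'
  proof -
    \<comment> \<open>The gap between \<open>c\<close> and \<open>c'\<close> later absorbs the
      factor \<open>root n B\<close>, which tends to 1.\<close>
    obtain c where c: "l < c" "c < c'" using dense[OF c'] by blast
    have c_pos: "0 < c" using l0 c by simp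
    have "\<exists>N\<in>{1..}. root N (a N) < c"
      using cINF_less_iff[OF _ bdd, of c] c(1) unfolding l_def by auto
    then obtain N where N: "N \<ge> 1" "root N (a N) < c" by auto
    have "root N (a N) ^ N \<le> c ^ N"
      using N nonneg by (intro power_mono) (auto simp: real_root_ge_zero)
    then have aN: "a N \<le> c ^ N"
      using N nonneg by (simp add: real_root_pow_pos2)
    \<comment> \<open>One constant serves all remainders \<open>r < N\<close>: each
      \<open>a r / c ^ r\<close> is a summand, and the extra 1 keeps \<open>B\<close> positive even
      if all of them vanish.\<close>
    define B where "B = 1 + (\<Sum>r<N. a r / c ^ r)"
    have B: "0 < B"
      unfolding B_def using nonneg c_pos by (intro add_pos_nonneg sum_nonneg) auto
    have bound: "a n \<le> c ^ n * B" for n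
    proof -
      define q r where "q = n div N" and "r = n mod N"
      have n: "n = q * N + r" and r: "r < N" using N by (auto simp: q_def r_def)
      have "a r / c ^ r \<le> (\<Sum>r<N. a r / c ^ r)"
        using r nonneg c_pos by (intro member_le_sum) auto
      then have "a r / c ^ r \<le> B" by (simp add: B_def)
      then have "a r \<le> c ^ r * B" using c_pos by (simp add: field_simps)
      then have "a N ^ q * a r \<le> (c ^ N) ^ q * (c ^ r * B)"
        using aN nonneg c_pos by (intro mult_mono power_mono) auto
      then show ?thesis
        using submultiplicative_power_bound[of a, OF nonneg submult, of q N r]
        by (simp add: n power_add power_mult mult.commute mult.left_commute)
    qed
    have "(\<lambda>n. c * root n B) \<longlonglongrightarrow> c * 1"
      using B by (intro tendsto_intros LIMSEQ_root_const)
    then have "\<forall>\<^sub>F n in sequentially. c * root n B < c'"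
      using c by (intro order_tendstoD) auto
    then show ?thesis
      using eventually_ge_at_top[of 1]
    proof eventually_elim
      case (elim n)
      have "root n (a n) \<le> root n (c ^ n * B)"
        using elim bound by (intro real_root_le_mono) auto
      also have "\<dots> = c * root n B"
        using elim c_pos by (simp add: real_root_mult real_root_power_cancel)
      finally show ?case using elim by simp
    qed
  qed
  show ?thesis
    unfolding l_def[symmetric]
  proof (rule order_tendstoI)
    fix y assume "y < l"
    then show "\<forall>\<^sub>F n in sequentially. y < root n (a n)"
      using lower by (intro eventually_sequentiallyI[of 1]) force
  qed (rule upper)
qed

section \<open>Minimum deviations and capacity of a compact nonempty set\<close>

text \<open>Serves to pass from a product bound for individual polynomials to one for minimum
  deviations. The case \<open>c = 0\<close> is split off because the other case divides by
  \<open>c\<close>.\<close>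

lemma le_mult_cINF:
  fixes f :: "'a \<Rightarrow> real"
  assumes "A \<noteq> {}" and "0 \<le> c" and "\<And>i. i \<in> A \<Longrightarrow> 0 \<le> f i"
    and "\<And>i. i \<in> A \<Longrightarrow> x \<le> c * f i"
  shows "x \<le> c * (INF i\<in>A. f i)"
proof (cases "c = 0")
  case True
  then show ?thesis using assms by auto
next
  case False
  then have "x / c \<le> (INF i\<in>A. f i)"
    using assms by (intro cINF_greatest) (auto simp: field_simps)
  then show ?thesis using False assms by (simp add: field_simps)
qed

lemma monic_polys_nonempty: "monic_polys n \<noteq> {}"
proof -
  have "monom 1 n \<in> monic_polys n"
    by (simp add: monic_polys_def degree_monom_eq)
  then show ?thesis by blast
qed

lemma monic_polys_mult:
  assumes "p \<in> monic_polys m" and "q \<in> monic_polys n"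
  shows "p * q \<in> monic_polys (m + n)"
proof -
  have "p \<noteq> 0" "q \<noteq> 0" using assms by (auto simp: monic_polys_def)
  then show ?thesis
    using assms lead_coeff_mult[of p q] by (auto simp: monic_polys_def degree_mult_eq)
qed

text \<open>Real suprema of empty or unbounded sets carry no information; nonemptiness and
  compactness exclude both cases for \<open>max_modulus\<close>.\<close>

locale compact_nonempty =
  fixes S :: "complex set"
  assumes compact: "compact S" and nonempty: "S \<noteq> {}"
begin

lemma modulus_le_max_modulus:
  assumes "z \<in> S"
  shows "cmod (poly p z) \<le> max_modulus S p"
  unfolding max_modulus_def
proof (rule cSUP_upper[OF assms])
  have "compact ((\<lambda>z. cmod (poly p z)) ` S)"
    by (intro compact_continuous_image compact continuous_intros)
  then show "bdd_above ((\<lambda>z. cmod (poly p z)) ` S)"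
    by (intro bounded_imp_bdd_above compact_imp_bounded)
qed

lemma max_modulus_le:
  assumes "\<And>z. z \<in> S \<Longrightarrow> cmod (poly p z) \<le> B"
  shows "max_modulus S p \<le> B"
  unfolding max_modulus_def using assms nonempty by (intro cSUP_least)

lemma max_modulus_nonneg: "0 \<le> max_modulus S p"
proof -
  obtain z where "z \<in> S" using nonempty by blast
  from modulus_le_max_modulus[OF this] show ?thesis
    by (rule order_trans[OF norm_ge_zero])
qed

lemma max_modulus_mult: "max_modulus S (p * q) \<le> max_modulus S p * max_modulus S q"
  by (rule max_modulus_le)
     (auto simp: norm_mult intro!: mult_mono modulus_le_max_modulus max_modulus_nonneg)

lemma min_deviation_le:
  assumes "p \<in> monic_polys n"
  shows "min_deviation n S \<le> max_modulus S p"
  unfolding min_deviation_def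
  by (rule cINF_lower[OF bdd_belowI2[of _ 0] assms]) (rule max_modulus_nonneg)

lemma min_deviation_nonneg: "0 \<le> min_deviation n S"
  unfolding min_deviation_def
  by (intro cINF_greatest monic_polys_nonempty max_modulus_nonneg)

text \<open>A product of monic polynomials competes in degree \<open>m + n\<close>; the infimum is
  then taken over one factor after the other.\<close>

lemma min_deviation_add: "min_deviation (m + n) S \<le> min_deviation m S * min_deviation n S"
proof -
  have "min_deviation (m + n) S \<le> max_modulus S p * max_modulus S q"
    if "p \<in> monic_polys m" "q \<in> monic_polys n" for p q
    using min_deviation_le[OF monic_polys_mult[OF that]] max_modulus_mult[of p q] by linarith
  then have "min_deviation (m + n) S \<le> max_modulus S p * min_deviation n S"
    if "p \<in> monic_polys m" for p
    unfolding min_deviation_def[of n]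
    using that by (intro le_mult_cINF monic_polys_nonempty max_modulus_nonneg)
  then show ?thesis
    unfolding min_deviation_def[of m] mult.commute[of _ "min_deviation n S"]
    by (intro le_mult_cINF monic_polys_nonempty max_modulus_nonneg min_deviation_nonneg)
qed

text \<open>Fekete's lemma makes the limit exist and identifies it with an infimum, so every single
  degree bounds the capacity from above.\<close>

lemma log_capacity_eq_INF: "log_capacity S = (INF n\<in>{1..}. root n (min_deviation n S))"
  unfolding log_capacity_def
  by (intro limI submultiplicative_root_limit min_deviation_nonneg min_deviation_add)

lemma log_capacity_nonneg: "0 \<le> log_capacity S"
  unfolding log_capacity_eq_INF
  by (intro cINF_greatest) (auto simp: real_root_ge_zero min_deviation_nonneg)

lemma log_capacity_power_le:
  assumes "n \<ge> 1"
  shows "log_capacity S ^ n \<le> min_deviation n S"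
proof -
  have "log_capacity S \<le> root n (min_deviation n S)"
    unfolding log_capacity_eq_INF using assms
    by (intro cINF_lower bdd_belowI2[of _ 0]) (auto simp: real_root_ge_zero min_deviation_nonneg)
  then have "log_capacity S ^ n \<le> root n (min_deviation n S) ^ n"
    by (intro power_mono log_capacity_nonneg)
  then show ?thesis
    using assms by (simp add: real_root_pow_pos2 min_deviation_nonneg)
qed

end

section \<open>Polynomials on the unit circle\<close>

text \<open>Since \<open>inverse z = cnj z\<close> on the unit circle, reflection makes the
  conjugate of a polynomial value, up to a power of \<open>z\<close>, again a polynomial
  value.\<close>

lemma poly_reflect_cnj_unit_circle:
  assumes "cmod z = 1"
  shows "poly (reflect_poly (map_poly cnj p)) z = z ^ degree p * cnj (poly p z)"
proof -
  have "z \<noteq> 0" using assms by auto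
  moreover have "inverse z = cnj z"
    using assms by (simp add: inverse_complex_def complex_eq_iff cmod_def)
  moreover have "degree (map_poly cnj p) = degree p"
    by (rule degree_map_poly) auto
  moreover have "poly (map_poly cnj p) (cnj z) = cnj (poly p z)"
    by (induction p) (auto simp: map_poly_pCons)
  ultimately show ?thesis
    by (simp add: poly_reflect_poly_nz)
qed

lemma (in compact_nonempty) min_deviation_unit_circle_le:
  assumes unit: "\<And>z. z \<in> S \<Longrightarrow> cmod z = 1"
    and Q: "Q \<in> monic_polys m" "m \<ge> 1" and b: "coeff Q 0 \<noteq> 0"
  shows "min_deviation (2 * m) S \<le> max_modulus S Q ^ 2 / (2 * cmod (coeff Q 0))"
proof -
  define M where "M = max_modulus S Q"
  define b where "b = cnj (coeff Q 0)"
  define R where "R = reflect_poly (map_poly cnj Q)"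
  \<comment> \<open>On the circle \<open>Q * R\<close> equals \<open>z ^ m\<close> times the squared
    modulus of \<open>Q\<close>, so this monomial shifts that square by the midpoint of its range
    \<open>[0, M^2]\<close>.\<close>
  define T where "T = Q * R - monom (of_real (M\<^sup>2 / 2)) m"
  have b0: "b \<noteq> 0" using b by (simp add: b_def)
  have Qm: "degree Q = m" "lead_coeff Q = 1" using Q by (auto simp: monic_polys_def)
  have coeff0: "coeff (map_poly cnj Q) 0 = b" by (simp add: b_def coeff_map_poly)
  have R: "degree R = m" "lead_coeff R = b"
  proof -
    \<comment> \<open>The nonzero constant term of \<open>Q\<close> keeps the degree from dropping
      under reflection and becomes, conjugated, the leading coefficient.\<close>
    show degR: "degree R = m"
      using coeff0 b0 Qm by (simp add: R_def degree_map_poly)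
    show "lead_coeff R = b"
      using coeff0 b0 by (simp add: R_def coeff_reflect_poly)
  qed
  have QR: "degree (Q * R) = 2 * m" "lead_coeff (Q * R) = b"
  proof -
    have "Q \<noteq> 0" "R \<noteq> 0" using Qm R b0 by auto
    then show "degree (Q * R) = 2 * m" using Qm R by (simp add: degree_mult_eq)
    show "lead_coeff (Q * R) = b" using lead_coeff_mult[of Q R] Qm R by simp
  qed
  \<comment> \<open>As \<open>m \<ge> 1\<close>, the degree \<open>m\<close> lies strictly below
    \<open>2 * m\<close>, and subtracting the monomial leaves the leading term alone.\<close>
  have "degree (monom (of_real (M\<^sup>2 / 2) :: complex) m) < degree (Q * R)"
    using QR Q(2) by (intro le_less_trans[OF degree_monom_le]) auto
  then have degT: "degree T = 2 * m"
    using QR(1) degree_add_eq_left[of "- monom (of_real (M\<^sup>2 / 2)) m" "Q * R"]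
    by (simp add: T_def)
  moreover have "lead_coeff T = b"
    unfolding degT using QR Q(2) by (simp add: T_def)
  ultimately have "smult (1 / b) T \<in> monic_polys (2 * m)"
    using b0 by (simp add: monic_polys_def)
  then have "min_deviation (2 * m) S \<le> max_modulus S (smult (1 / b) T)"
    by (rule min_deviation_le)
  also have "\<dots> \<le> M\<^sup>2 / (2 * cmod b)"
  proof (rule max_modulus_le)
    fix z assume z: "z \<in> S"
    have "poly (Q * R) z = z ^ m * of_real ((cmod (poly Q z))\<^sup>2)"
      using poly_reflect_cnj_unit_circle[OF unit[OF z], of Q] Qm
      by (simp add: R_def complex_norm_square del: of_real_power)
    then have "poly T z = z ^ m * of_real ((cmod (poly Q z))\<^sup>2 - M\<^sup>2 / 2)"
      by (simp add: T_def poly_monom algebra_simps)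
    then have "cmod (poly T z) = \<bar>(cmod (poly Q z))\<^sup>2 - M\<^sup>2 / 2\<bar>"
      using unit[OF z] by (simp only: norm_mult norm_power norm_of_real) simp
    moreover have "(cmod (poly Q z))\<^sup>2 \<le> M\<^sup>2"
      unfolding M_def using modulus_le_max_modulus[OF z] by (intro power_mono) auto
    moreover have "0 \<le> (cmod (poly Q z))\<^sup>2" by simp
    ultimately have "cmod (poly T z) \<le> M\<^sup>2 / 2" by linarith
    then show "cmod (poly (smult (1 / b) T) z) \<le> M\<^sup>2 / (2 * cmod b)"
      using b0 by (simp add: norm_mult norm_divide field_simps)
  qed
  finally show ?thesis by (simp add: M_def b_def)
qed

text \<open>Splits off the exact power of the variable dividing \<open>P\<close>, so that the
  quotient has the nonzero constant term that reflection requires.\<close>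

lemma poly_shift_LEAST_coeff:
  fixes P :: "'a::comm_semiring_1 poly"
  assumes "P \<noteq> 0" and k: "k = (LEAST j. coeff P j \<noteq> 0)"
  shows "P = monom 1 k * poly_shift k P" and "degree (poly_shift k P) = degree P - k"
    and "coeff P k \<noteq> 0"
proof -
  have "coeff P (degree P) \<noteq> 0" using assms(1) by simp
  then show "coeff P k \<noteq> 0" unfolding k by (rule LeastI)
  then have kd: "k \<le> degree P" by (rule le_degree)
  have "coeff P j = 0" if "j < k" for j
    using not_less_Least that unfolding k by blast
  then show "P = monom 1 k * poly_shift k P"
    by (auto simp: poly_eq_iff coeff_monom_mult coeff_poly_shift)
  show "degree (poly_shift k P) = degree P - k"
  proof (rule antisym)
    show "degree (poly_shift k P) \<le> degree P - k"
      by (rule degree_le) (auto simp: coeff_poly_shift coeff_eq_0)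
    show "degree P - k \<le> degree (poly_shift k P)"
      using assms(1) kd by (intro le_degree) (auto simp: coeff_poly_shift)
  qed
qed

theorem theorem6:
  fixes C :: "real set" and \<Gamma> :: "complex set"
    and P :: "complex poly" and n k :: nat
  assumes "compact C" and "infinite C" and "C \<subseteq> {-1..1}"
    and "\<Gamma> = {z. cmod z = 1 \<and> Re z \<in> C}"
    and "n \<ge> 1"
    and "is_minimal_poly n \<Gamma> P"
    and "k = (LEAST j. coeff P j \<noteq> 0)"
    and "k \<noteq> n"
  shows "min_deviation n \<Gamma> \<ge> sqrt (2 * cmod (coeff P k)) * log_capacity \<Gamma> ^ (n - k)"
proof -
  interpret compact_nonempty \<Gamma>
  proof
    have "\<Gamma> = sphere 0 1 \<inter> Re -` C" using assms(4) by auto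
    moreover have "closed (Re -` C)"
      using assms(1) by (intro continuous_closed_vimage compact_imp_closed continuous_intros)
    ultimately show "compact \<Gamma>" by (auto intro: compact_Int_closed)
    obtain x where x: "x \<in> C" using assms(2) by (metis finite.emptyI ex_in_conv)
    then have "x\<^sup>2 \<le> 1" using assms(3) by (auto simp: abs_square_le_1 abs_le_iff)
    \<comment> \<open>The point of the closed upper half of the unit circle with real part
      \<open>x\<close>.\<close>
    then have "Complex x (sqrt (1 - x\<^sup>2)) \<in> \<Gamma>"
      using x assms(4) by (simp add: cmod_def)
    then show "\<Gamma> \<noteq> {}" by blast
  qed
  have P: "degree P = n" "lead_coeff P = 1" "max_modulus \<Gamma> P = min_deviation n \<Gamma>"
    using assms(6) by (auto simp: is_minimal_poly_def monic_polys_def)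
  define Q where "Q = poly_shift k P"
  define m where "m = n - k"
  define b where "b = cmod (coeff P k)"
  have "P \<noteq> 0" using P by auto
  note PQ = poly_shift_LEAST_coeff[OF this assms(7), folded Q_def]
  have "k \<le> n" using le_degree[OF PQ(3)] P by simp
  then have m: "m \<ge> 1" using assms(8) by (simp add: m_def)
  have Q: "Q \<in> monic_polys m"
    using P PQ(2) \<open>k \<le> n\<close> by (auto simp: monic_polys_def m_def Q_def coeff_poly_shift)
  have Q0: "coeff Q 0 = coeff P k" by (simp add: Q_def coeff_poly_shift)
  have unit: "cmod z = 1" if "z \<in> \<Gamma>" for z using that assms(4) by simp
  \<comment> \<open>The split-off power has modulus 1 on \<open>\<Gamma>\<close>, so
    \<open>Q\<close> inherits the maximum of \<open>P\<close>, which minimality identifies with the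
    minimum deviation.\<close>
  have "cmod (poly P z) = cmod (poly Q z)" if "z \<in> \<Gamma>" for z
    using unit[OF that] by (subst PQ(1)) (simp add: poly_monom norm_mult norm_power)
  then have M: "max_modulus \<Gamma> Q = min_deviation n \<Gamma>"
    using P(3) by (simp add: max_modulus_def cong: SUP_cong)
  have "log_capacity \<Gamma> ^ (2 * m) \<le> min_deviation (2 * m) \<Gamma>"
    using m by (intro log_capacity_power_le) auto
  also have "\<dots> \<le> (min_deviation n \<Gamma>)\<^sup>2 / (2 * b)"
    using min_deviation_unit_circle_le[OF unit Q m] PQ(3) by (simp add: M Q0 b_def)
  \<comment> \<open>Writing the exponent \<open>2 * m\<close> as a square lets the final square root
    restore \<open>m = n - k\<close> and produce \<open>sqrt (2 * b)\<close>.\<close>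
  finally have "2 * b * (log_capacity \<Gamma> ^ m)\<^sup>2 \<le> (min_deviation n \<Gamma>)\<^sup>2"
    using PQ(3) by (simp add: b_def field_simps flip: power_mult)
  then have "(sqrt (2 * b) * log_capacity \<Gamma> ^ m)\<^sup>2 \<le> (min_deviation n \<Gamma>)\<^sup>2"
    by (simp add: power_mult_distrib b_def)
  then show ?thesis
    unfolding b_def m_def by (rule power2_le_imp_le) (rule min_deviation_nonneg)
qed

end
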